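(* For any $r\in\mathbb{N}$, any two distinct natural numbers $a,b$ and any $2$-coloring of $\mathbb{N}$, there exist two sets $B,C\subset\mathbb{N}$ with $|B|=r$ and $|C|=\infty$ such that there exists some color (a single color class) which contains both $B+aC$ and $B+bC$.
   Context: $\mathbb{N}=\{1,2,3,\ldots\}$ is the set of natural numbers. A $2$-coloring of $\mathbb{N}$ is a map from $\mathbb{N}$ to a two-element set; its colors (color classes) are the preimages of the two elements. For $B,C\subset\mathbb{N}$ and $a\in\mathbb{N}$, $B+aC=\{\beta+a\gamma:\beta\in B,\gamma\in C\}$. *)

theory Defs
  imports "HOL-Library.FuncSet"
begin

text \<open>The natural numbers here start at 1, so they are the subset \<open>{1..}\<close> of type nat.\<close>

abbreviation pos_nats :: "nat set" where
  "pos_nats \<equiv> {1..}"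

text \<open>The value of \<open>f\<close> at 0 is unconstrained and is never used.\<close>

definition two_coloring :: "(nat \<Rightarrow> 'c) \<Rightarrow> 'c set \<Rightarrow> bool" where
  "two_coloring f K \<longleftrightarrow> card K = 2 \<and> f \<in> pos_nats \<rightarrow> K"

definition color_class :: "(nat \<Rightarrow> 'c) \<Rightarrow> 'c \<Rightarrow> nat set" where
  "color_class f k = {n \<in> pos_nats. f n = k}"

definition sum_dilate :: "nat set \<Rightarrow> nat \<Rightarrow> nat set \<Rightarrow> nat set" where
  "sum_dilate B a C = {\<beta> + a * \<gamma> | \<beta> \<gamma>. \<beta> \<in> B \<and> \<gamma> \<in> C}"

end

theory Submission
  imports Defs
begin

text \<open>
  Let \<open>a < b\<close>, put \<open>d = b - a\<close>, and regard the coloring as a predicate \<open>g\<close>. Call \<open>n\<close> an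
  agreement of \<open>\<gamma>\<close> if \<open>g (n + a * \<gamma>) = g (n + b * \<gamma>)\<close>. If for some \<open>N\<close> infinitely many \<open>\<gamma>\<close>
  have \<open>2 * r\<close> agreements in \<open>{1..N}\<close>, then the pigeonhole principle, applied to the finitely
  many pairs of an \<open>r\<close>-element subset of \<open>{1..N}\<close> and a color, gives \<open>B\<close> and \<open>C\<close>
  (\<open>monochromatic_of_frequent_agreements\<close>).

  Otherwise, for every \<open>N\<close> and all large \<open>\<gamma>\<close>, passing from \<open>n + a * \<gamma>\<close> to \<open>n + b * \<gamma>\<close> flips
  the color for all but a bounded number of \<open>n\<close> in \<open>{1..N}\<close>, and the bound does not depend
  on \<open>N\<close>. The points
  \<open>n + a * s + b * \<gamma>\<close> and \<open>n + b * (\<gamma> + s)\<close> both arise by such a flip from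
  the single point \<open>n + a * (\<gamma> + s)\<close>. As there are only two colors, two flips cancel, so far
  from the origin a shift by \<open>d * s\<close> preserves the color with a number of exceptions that is
  bounded independently of \<open>s\<close> and of the length of the window
  (\<open>few_changes_under_shifts\<close>). A sequence that is so insensitive to all shifts is almost
  constant (\<open>almost_constant_of_shifts\<close>): in a long segment of a progression of difference
  \<open>d\<close>, one color occurs only boundedly often. Sliding the segment by one step changes a count
  by at most one, so the dominant color never changes along the progression. But the segments
  that start at \<open>1 + a * \<gamma>\<close> and at \<open>1 + b * \<gamma>\<close> lie on the same progression, and their colors
  are almost everywhere opposite: a contradiction (\<open>not_few_agreements\<close>).
\<close>

section \<open>Frequent agreements\<close>

lemma monochromatic_of_frequent_agreements:
  fixes g :: "nat \<Rightarrow> bool" and a b r N :: nat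
  assumes inf: "infinite {\<gamma>. 2 * r \<le> card {n \<in> {1..N}. g (n + a * \<gamma>) = g (n + b * \<gamma>)}}"
  shows "\<exists>B C k. B \<subseteq> {1..N} \<and> card B = r \<and> C \<subseteq> {1..} \<and> infinite C \<and>
    (\<forall>\<beta>\<in>B. \<forall>\<gamma>\<in>C. g (\<beta> + a * \<gamma>) = k \<and> g (\<beta> + b * \<gamma>) = k)"
proof -
  define A where "A = {\<gamma>. 2 * r \<le> card {n \<in> {1..N}. g (n + a * \<gamma>) = g (n + b * \<gamma>)}} - {0}"
  have infA: "infinite A"
    using inf by (simp add: A_def)
  define P where "P = (\<lambda>\<gamma> (B, k). B \<subseteq> {1..N} \<and> card B = r \<and>
    (\<forall>\<beta>\<in>B. g (\<beta> + a * \<gamma>) = k \<and> g (\<beta> + b * \<gamma>) = k))"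
  have ex: "\<exists>Bk \<in> Pow {1..N} \<times> UNIV. P \<gamma> Bk" if "\<gamma> \<in> A" for \<gamma>
  proof -
    define S where "S = (\<lambda>k. {n \<in> {1..N}. g (n + a * \<gamma>) = k \<and> g (n + b * \<gamma>) = k})"
    have "{n \<in> {1..N}. g (n + a * \<gamma>) = g (n + b * \<gamma>)} = S True \<union> S False"
      by (auto simp: S_def)
    then have "2 * r \<le> card (S True) + card (S False)"
      using that card_Un_le[of "S True" "S False"] by (simp add: A_def)
    then have "r \<le> card (S True) \<or> r \<le> card (S False)"
      by linarith
    then obtain k where "r \<le> card (S k)"
      by blast
    then obtain B where "B \<subseteq> S k" "card B = r"
      by (meson obtain_subset_with_card_n)
    then have "P \<gamma> (B, k)" "B \<in> Pow {1..N}"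
      unfolding P_def S_def by auto
    then show ?thesis by blast
  qed
  have "finite (Pow {1..N} \<times> (UNIV :: bool set))"
    by simp
  from pigeonhole_infinite_rel[OF infA this] ex
  obtain Bk where inf': "infinite {\<gamma> \<in> A. P \<gamma> Bk}"
    by blast
  obtain B k where Bk: "Bk = (B, k)"
    by (cases Bk)
  define C where "C = {\<gamma> \<in> A. P \<gamma> (B, k)}"
  have infC: "infinite C"
    using inf' by (simp add: C_def Bk)
  then obtain \<gamma>0 where "\<gamma>0 \<in> C"
    by (metis finite.emptyI ex_in_conv)
  then have "B \<subseteq> {1..N} \<and> card B = r"
    by (simp add: C_def P_def)
  moreover have "C \<subseteq> {1..}"
    by (auto simp: C_def A_def)
  moreover have "\<forall>\<beta>\<in>B. \<forall>\<gamma>\<in>C. g (\<beta> + a * \<gamma>) = k \<and> g (\<beta> + b * \<gamma>) = k"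
    by (simp add: C_def P_def)
  ultimately show ?thesis
    using infC by blast
qed

section \<open>Shifts by multiples of the difference\<close>

text \<open>
  Both \<open>n + a * s + b * \<gamma>\<close> and \<open>n + b * (\<gamma> + s)\<close> are partners of \<open>n + a * (\<gamma> + s)\<close>, for the
  multipliers \<open>\<gamma>\<close> and \<open>\<gamma> + s\<close>; they differ by \<open>d * s\<close>. Their colors differ only if \<open>n + a * s\<close>
  is an agreement of \<open>\<gamma>\<close> or \<open>n\<close> is one of \<open>\<gamma> + s\<close>.
\<close>

lemma few_changes_under_shifts:
  fixes g :: "nat \<Rightarrow> bool" and a b d m L :: nat
  assumes b: "b = a + d" and d: "0 < d"
    and few: "\<And>N. \<exists>G. \<forall>\<gamma>\<ge>G. card {n \<in> {1..N}. g (n + a * \<gamma>) = g (n + b * \<gamma>)} < m"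
  shows "\<exists>X0. \<forall>X\<ge>X0. \<forall>s\<le>L. card {j \<in> {..<L}. g (X + d * j) \<noteq> g (X + d * (j + s))} \<le> 2 * m"
proof -
  \<comment> \<open>\<open>N\<close> bounds every \<open>n\<close> and \<open>n + a * s\<close> that occurs for the choice of \<open>\<gamma>\<close> made below.\<close>
  define N where "N = b + a * L + 1 + d * L"
  obtain G where G: "\<And>\<gamma>. G \<le> \<gamma> \<Longrightarrow> card {n \<in> {1..N}. g (n + a * \<gamma>) = g (n + b * \<gamma>)} < m"
    using few by meson
  have main: "card {j \<in> {..<L}. g (X + d * j) \<noteq> g (X + d * (j + s))} \<le> 2 * m"
    if X: "a * L + 1 + b * G \<le> X" and s: "s \<le> L" for X s
  proof -
    \<comment> \<open>\<open>b * \<gamma>\<close> lies below \<open>X\<close> by at least \<open>a * L + 1\<close>, so that \<open>n = v j\<close> is positive in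
        \<open>X + d * (j + s) = n + b * (\<gamma> + s)\<close>, where \<open>b * s\<close> exceeds \<open>d * s\<close> by \<open>a * s\<close>.
        The number \<open>u j\<close> is \<open>n + a * s\<close>.\<close>
    define \<gamma> where "\<gamma> = (X - (a * L + 1)) div b"
    define e where "e = (X - (a * L + 1)) mod b"
    have bpos: "0 < b" using b d by simp
    have "e < b" using bpos by (simp add: e_def)
    have Xeq: "X = a * L + 1 + b * \<gamma> + e"
      using X div_mult_mod_eq[of "X - (a * L + 1)" b]
      by (simp add: \<gamma>_def e_def mult.commute)
    have "b * G \<le> X - (a * L + 1)" using X by simp
    then have G\<gamma>: "G \<le> \<gamma>"
      using bpos unfolding \<gamma>_def by (metis div_le_mono nonzero_mult_div_cancel_left not_gr0)
    have asL: "a * (L - s) + a * s = a * L"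
      using s by (metis add_mult_distrib2 le_add_diff_inverse2)
    define u where "u = (\<lambda>j. a * L + 1 + e + d * j)"
    define v where "v = (\<lambda>j. a * (L - s) + 1 + e + d * j)"
    have uv: "u j = v j + a * s" for j
      using asL by (simp add: u_def v_def)
    have bound: "u j \<in> {1..N}" "v j \<in> {1..N}" if "j < L" for j
    proof -
      have "d * j \<le> d * L" using that by simp
      then have "u j \<le> N"
        using \<open>e < b\<close> unfolding u_def N_def by linarith
      moreover have "1 \<le> v j" by (simp add: v_def)
      ultimately show "u j \<in> {1..N}" "v j \<in> {1..N}"
        using uv[of j] by auto
    qed
    define E1 where "E1 = {n \<in> {1..N}. g (n + a * \<gamma>) = g (n + b * \<gamma>)}"
    define E2 where "E2 = {n \<in> {1..N}. g (n + a * (\<gamma> + s)) = g (n + b * (\<gamma> + s))}"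
    have c: "card E1 < m" "card E2 < m"
      using G G\<gamma> by (simp_all add: E1_def E2_def)
    have fin: "finite E1" "finite E2" by (simp_all add: E1_def E2_def)
    have inj: "inj u" "inj v"
      using d by (auto simp: inj_def u_def v_def)
    have "{j \<in> {..<L}. g (X + d * j) \<noteq> g (X + d * (j + s))} \<subseteq> u -` E1 \<union> v -` E2"
    proof
      fix j assume j: "j \<in> {j \<in> {..<L}. g (X + d * j) \<noteq> g (X + d * (j + s))}"
      have "X + d * j = u j + b * \<gamma>"
        by (simp add: Xeq u_def)
      moreover have "X + d * (j + s) = v j + b * (\<gamma> + s)"
      proof -
        have "X + d * (j + s) = u j + b * \<gamma> + d * s"
          by (simp add: Xeq u_def algebra_simps)
        then show ?thesis by (simp add: uv b algebra_simps)
      qed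
      moreover have "u j + a * \<gamma> = v j + a * (\<gamma> + s)"
        by (simp add: uv algebra_simps)
      ultimately show "j \<in> u -` E1 \<union> v -` E2"
        using j bound[of j] by (auto simp: E1_def E2_def)
    qed
    then have "card {j \<in> {..<L}. g (X + d * j) \<noteq> g (X + d * (j + s))}
        \<le> card (u -` E1 \<union> v -` E2)"
      using fin inj by (intro card_mono) (auto intro: finite_vimageI)
    also have "\<dots> \<le> card (u -` E1) + card (v -` E2)"
      by (rule card_Un_le)
    also have "\<dots> \<le> card E1 + card E2"
      using card_vimage_inj_on_le[OF inj(1) fin(1)] card_vimage_inj_on_le[OF inj(2) fin(2)]
      by simp
    finally show ?thesis using c by simp
  qed
  then show ?thesis by blast
qed

text \<open>
  If \<open>p\<close> of the \<open>L\<close> terms are true, then \<open>p * (L - p)\<close> pairs consist of a true and a false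
  term. Sorted by their distance \<open>s < L\<close>, there are at most \<open>K * L\<close> such pairs.
\<close>

lemma almost_constant_of_shifts:
  fixes w :: "nat \<Rightarrow> bool" and L K :: nat
  assumes sh: "\<And>s. s \<le> L \<Longrightarrow> card {j \<in> {..<L}. w j \<noteq> w (j + s)} \<le> K"
  shows "card {j \<in> {..<L}. w j} \<le> 2 * K \<or> L \<le> card {j \<in> {..<L}. w j} + 2 * K"
proof -
  define T where "T = {j \<in> {..<L}. w j}"
  define F where "F = {j \<in> {..<L}. \<not> w j}"
  have TF: "card T + card F = L"
  proof -
    have "T \<union> F = {..<L}" "T \<inter> F = {}" by (auto simp: T_def F_def)
    then show ?thesis
      by (metis card_Un_disjoint card_lessThan finite_Un finite_lessThan)
  qed
  define D where "D = (SIGMA s:{..<L}. {j \<in> {..<L}. w j \<noteq> w (j + s)})"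
  define h where "h = (\<lambda>(i, j). (max i j - min i j, min i j :: nat))"
  have "inj_on h (T \<times> F)"
    by (auto simp: inj_on_def h_def T_def F_def max_def min_def split: if_splits)
  moreover have "h ` (T \<times> F) \<subseteq> D"
    by (auto simp: h_def T_def F_def D_def max_def min_def split: if_splits)
  moreover have "finite D" by (simp add: D_def)
  ultimately have "card (T \<times> F) \<le> card D"
    by (metis card_inj_on_le)
  also have "card D = (\<Sum>s<L. card {j \<in> {..<L}. w j \<noteq> w (j + s)})"
    by (simp add: D_def)
  also have "\<dots> \<le> (\<Sum>s<L. K)"
    by (intro sum_mono sh) simp
  finally have le: "card T * card F \<le> L * K"
    by (simp add: card_cartesian_product)
  \<comment> \<open>The larger count is at least half of \<open>L\<close>, so the smaller one is at most \<open>2 * K\<close>.\<close>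
  have aux: "x \<le> 2 * K" if "x * y \<le> (x + y) * K" "x \<le> y" for x y :: nat
  proof (cases "y = 0")
    case False
    have "(x + y) * K \<le> (2 * y) * K" using that by (intro mult_right_mono) auto
    with that(1) have "x * y \<le> (2 * y) * K" by (rule order_trans)
    then have "x * y \<le> (2 * K) * y" by (simp add: mult_ac)
    then show ?thesis using False by (metis mult_le_cancel2 not_gr0)
  qed (use that in auto)
  have "card T \<le> 2 * K \<or> card F \<le> 2 * K"
    using aux[of "card T" "card F"] aux[of "card F" "card T"] le TF
    by (metis add.commute mult.commute nle_le)
  then show ?thesis using TF unfolding T_def by linarith
qed

section \<open>The dominant color\<close>

text \<open>
  With fewer than \<open>m\<close> agreements, the segments at \<open>1 + a * \<gamma>\<close> and \<open>1 + b * \<gamma>\<close> are nearly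
  complementary. But \<open>d * \<gamma>\<close> is their distance, so they are joined by \<open>\<gamma>\<close> steps of length \<open>d\<close>,
  along which the dominant color stays the same.
\<close>

lemma not_few_agreements:
  fixes g :: "nat \<Rightarrow> bool" and a b m :: nat
  assumes a: "0 < a" and ab: "a < b"
  shows "\<exists>N. infinite {\<gamma>. m \<le> card {n \<in> {1..N}. g (n + a * \<gamma>) = g (n + b * \<gamma>)}}"
proof (rule ccontr)
  assume neg: "\<not> ?thesis"
  have few: "\<exists>G. \<forall>\<gamma>\<ge>G. card {n \<in> {1..N}. g (n + a * \<gamma>) = g (n + b * \<gamma>)} < m" for N
  proof -
    have "finite {\<gamma>. m \<le> card {n \<in> {1..N}. g (n + a * \<gamma>) = g (n + b * \<gamma>)}}"
      using neg by blast
    then obtain G where "\<And>\<gamma>. m \<le> card {n \<in> {1..N}. g (n + a * \<gamma>) = g (n + b * \<gamma>)} \<Longrightarrow> \<gamma> \<le> G"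
      unfolding finite_nat_set_iff_bounded_le by blast
    then show ?thesis
      by (metis not_less_eq_eq linorder_not_less)
  qed
  define d where "d = b - a"
  have d: "0 < d" "b = a + d" using ab by (simp_all add: d_def)
  \<comment> \<open>With \<open>K = 2 * m\<close>, the counts that \<open>almost_constant_of_shifts\<close> allows are at most \<open>2 * K\<close>
      or at least \<open>L - 2 * K\<close>. The gap in between has length \<open>4 * m + 2\<close>: one step cannot
      cross it, and it exceeds the number of agreements.\<close>
  define L where "L = 12 * m + 2"
  define c where "c = (\<lambda>x. card {j \<in> {..<L}. g (x + d * j)})"
  obtain X0 where X0: "\<And>X s. X0 \<le> X \<Longrightarrow> s \<le> L \<Longrightarrow>
      card {j \<in> {..<L}. g (X + d * j) \<noteq> g (X + d * (j + s))} \<le> 2 * m"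
    using few_changes_under_shifts[OF d(2,1) few] by meson
  have dich: "c x \<le> 4 * m \<or> L \<le> c x + 4 * m" if "X0 \<le> x" for x
    using almost_constant_of_shifts[of L "\<lambda>j. g (x + d * j)" "2 * m"] X0[OF that]
    by (simp add: c_def)
  have step: "c (x + d) \<le> c x + 1" "c x \<le> c (x + d) + 1" for x
  proof -
    let ?A = "{j \<in> {..<L}. g (x + d * j)}"
    let ?B = "{j \<in> {..<L}. g (x + d + d * j)}"
    have cB: "card (Suc ` ?B) = card ?B" by (simp add: card_image)
    have "Suc ` ?B \<subseteq> insert L ?A" by (auto simp: algebra_simps)
    from card_mono[OF _ this] cB show "c (x + d) \<le> c x + 1"
      unfolding c_def by (simp add: card_insert_if split: if_splits)
    have "?A \<subseteq> insert 0 (Suc ` ?B)"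
    proof
      fix j assume "j \<in> ?A"
      then show "j \<in> insert 0 (Suc ` ?B)"
        by (cases j) (auto simp: algebra_simps)
    qed
    from card_mono[OF _ this] cB show "c x \<le> c (x + d) + 1"
      unfolding c_def by (simp add: card_insert_if split: if_splits)
  qed
  have same: "(c (x + d) \<le> 4 * m) = (c x \<le> 4 * m)" if "X0 \<le> x" for x
    using dich[OF that] dich[of "x + d"] that step[of x] by (auto simp: L_def)
  have const: "(c (x + d * i) \<le> 4 * m) = (c x \<le> 4 * m)" if "X0 \<le> x" for x i
  proof (induction i)
    case (Suc i)
    have "(c (x + d * i + d) \<le> 4 * m) = (c (x + d * i) \<le> 4 * m)"
      using that by (intro same) simp
    then show ?case using Suc by (simp add: add_ac)
  qed simp
  obtain G where G: "\<And>\<gamma>. G \<le> \<gamma> \<Longrightarrow>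
      card {n \<in> {1..1 + d * L}. g (n + a * \<gamma>) = g (n + b * \<gamma>)} < m"
    using few by meson
  define \<gamma> where "\<gamma> = G + X0"
  define x where "x = 1 + a * \<gamma>"
  define y where "y = 1 + b * \<gamma>"
  define S where "S = {j \<in> {..<L}. g (x + d * j) = g (y + d * j)}"
  have y: "y = x + d * \<gamma>" by (simp add: x_def y_def d(2) algebra_simps)
  have "card S \<le> card {n \<in> {1..1 + d * L}. g (n + a * \<gamma>) = g (n + b * \<gamma>)}"
  proof (rule card_inj_on_le[where f = "\<lambda>j. 1 + d * j"])
    show "inj_on (\<lambda>j. 1 + d * j) S" using d by (simp add: inj_on_def)
    show "(\<lambda>j. 1 + d * j) ` S \<subseteq> {n \<in> {1..1 + d * L}. g (n + a * \<gamma>) = g (n + b * \<gamma>)}"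
      by (auto simp: S_def x_def y_def add_ac)
  qed simp
  also have "\<dots> < m" by (intro G) (simp add: \<gamma>_def)
  finally have Sm: "card S < m" .
  define A where "A = {j \<in> {..<L}. g (x + d * j)}"
  define B where "B = {j \<in> {..<L}. g (y + d * j)}"
  have fin: "finite A" "finite B" "finite S" by (simp_all add: A_def B_def S_def)
  \<comment> \<open>Outside \<open>S\<close> exactly one of \<open>A\<close> and \<open>B\<close> holds, so \<open>c x + c y\<close> is within \<open>card S\<close> of \<open>L\<close>.
      Two counts on the same side of the gap cannot have such a sum.\<close>
  have 1: "L \<le> c x + c y + card S"
  proof -
    have "{..<L} \<subseteq> A \<union> B \<union> S" by (auto simp: A_def B_def S_def)
    from card_mono[OF _ this] fin have "L \<le> card (A \<union> B \<union> S)" by simp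
    also have "\<dots> \<le> card A + card B + card S"
      by (meson add_right_mono card_Un_le order_trans)
    finally show ?thesis by (simp add: c_def A_def B_def)
  qed
  have 2: "c x + c y \<le> L + card S"
  proof -
    have "card A + card B = card (A \<union> B) + card (A \<inter> B)"
      using fin by (intro card_Un_Int)
    also have "card (A \<union> B) \<le> card {..<L}"
      by (intro card_mono) (auto simp: A_def B_def)
    also have "card (A \<inter> B) \<le> card S"
      using fin by (intro card_mono) (auto simp: A_def B_def S_def)
    finally show ?thesis by (simp add: c_def A_def B_def)
  qed
  have "\<gamma> \<le> a * \<gamma>" using a by simp
  then have "X0 \<le> x"
    unfolding x_def using \<gamma>_def by linarith
  then have "c x \<le> 4 * m \<and> c y \<le> 4 * m \<or> L \<le> c x + 4 * m \<and> L \<le> c y + 4 * m"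
    using const[of x \<gamma>] dich[of x] dich[of y] y by auto
  then show False using 1 2 Sm unfolding L_def by linarith
qed

section \<open>Monochromatic sums with two dilates\<close>

theorem theorem1p7:
  fixes r a b :: nat and f :: "nat \<Rightarrow> 'c" and K :: "'c set"
  assumes "r \<in> pos_nats" and "a \<in> pos_nats" and "b \<in> pos_nats" and "a \<noteq> b"
    and "two_coloring f K"
  shows "\<exists>B C. B \<subseteq> pos_nats \<and> C \<subseteq> pos_nats \<and> card B = r \<and> infinite C \<and>
    (\<exists>k\<in>K. sum_dilate B a C \<subseteq> color_class f k \<and> sum_dilate B b C \<subseteq> color_class f k)"
proof -
  obtain k0 k1 where K: "K = {k0, k1}"
    using assms(5) by (auto simp: two_coloring_def card_2_iff)
  have fK: "f n = k0 \<or> f n = k1" if "1 \<le> n" for n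
    using assms(5) that K by (auto simp: two_coloring_def Pi_iff)
  define g where "g = (\<lambda>n. f n = k0)"
  have "\<exists>N. infinite {\<gamma>. 2 * r \<le> card {n \<in> {1..N}. g (n + a * \<gamma>) = g (n + b * \<gamma>)}}"
  proof (cases "a < b")
    case True
    with assms(2) show ?thesis by (intro not_few_agreements) auto
  next
    case False
    then have "0 < b" "b < a" using assms(3,4) by simp_all
    from not_few_agreements[OF this] show ?thesis by (simp add: eq_commute)
  qed
  then obtain N where
    N: "infinite {\<gamma>. 2 * r \<le> card {n \<in> {1..N}. g (n + a * \<gamma>) = g (n + b * \<gamma>)}}" ..
  obtain B C k where B: "B \<subseteq> {1..N}" "card B = r" and C: "C \<subseteq> {1..}" "infinite C"
    and mono: "\<And>\<beta> \<gamma>. \<beta> \<in> B \<Longrightarrow> \<gamma> \<in> C \<Longrightarrow> g (\<beta> + a * \<gamma>) = k \<and> g (\<beta> + b * \<gamma>) = k"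
    using monochromatic_of_frequent_agreements[OF N] by auto
  define k' where "k' = (if k then k0 else k1)"
  have col: "f n = k'" if "1 \<le> n" "g n = k" for n
    using that fK[OF that(1)] by (auto simp: k'_def g_def)
  have B1: "1 \<le> \<beta>" if "\<beta> \<in> B" for \<beta> using that B by auto
  have "sum_dilate B a C \<subseteq> color_class f k'" "sum_dilate B b C \<subseteq> color_class f k'"
    using mono B1 col[OF trans_le_add1]
    by (auto simp: sum_dilate_def color_class_def trans_le_add1)
  moreover have "k' \<in> K" by (simp add: k'_def K)
  moreover have "B \<subseteq> pos_nats" using B1 by auto
  ultimately show ?thesis using B(2) C by blast
qed

end
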